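(* Let $\omega$ be a weight. Let $f$ be a polynomial with simple zeros such that $Z(f)\cap\mathbb{D}=\emptyset$, and for each $n\in\mathbb{N}$ let $p_n$ be the $n$-th optimal polynomial approximant to $1/f$ in $H^2_\omega$. Then $$1-p_nf\to0\quad\text{as }n\to\infty,$$ uniformly on compact subsets of $\overline{\mathbb{D}}\setminus Z(f)$.
   Context: $\mathbb{N}=\{0,1,2,\dots\}$, $\mathbb{D}=\{z\in\mathbb{C}:|z|<1\}$, $\overline{\mathbb{D}}$ its closure; $Z(f)$ is the set of zeros of $f$ in $\mathbb{C}$. A weight is a monotone (nondecreasing or nonincreasing) sequence $\omega=\{\omega_k\}_{k\in\mathbb{N}}$ of positive reals with $\omega_0=1$, $\lim_{n\to\infty}\omega_n/\omega_{n-\lfloor\sqrt n\rfloor}=1$, and $\sum_{k=1}^\infty 1/\omega_k=+\infty$. $H^2_\omega$ is the Hilbert space of holomorphic functions $g(z)=\sum_{k\ge0}a_kz^k$ on $\mathbb{D}$ with $\|g\|_\omega^2=\sum_{k\ge0}|a_k|^2\omega_k<\infty$. $\mathcal{P}_n$ is the space of complex polynomials of degree at most $n$. For $f\in H^2_\omega$ not identically zero, the $n$-th optimal polynomial approximant to $1/f$ in $H^2_\omega$ is the unique $p_n\in\mathcal{P}_n$ such that $\|1-p_nf\|_\omega\le\|1-qf\|_\omega$ for all $q\in\mathcal{P}_n$. *)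

theory Defs
  imports "HOL-Complex_Analysis.Complex_Analysis" "HOL-Computational_Algebra.Polynomial"
begin

definition weight :: "(nat \<Rightarrow> real) \<Rightarrow> bool" where
  "weight \<omega> \<longleftrightarrow>
     (mono \<omega> \<or> antimono \<omega>) \<and>
     (\<forall>k. \<omega> k > 0) \<and>
     \<omega> 0 = 1 \<and>
     (\<lambda>n. \<omega> n / \<omega> (n - nat \<lfloor>sqrt (real n)\<rfloor>)) \<longlonglongrightarrow> 1 \<and>
     filterlim (\<lambda>n. \<Sum>k=1..n. 1 / \<omega> k) at_top sequentially"

text \<open>
  Elements of the space are represented by total functions on the complex plane, of which
  only the values on the open unit disc matter.
\<close>

definition weighted_H2 :: "(nat \<Rightarrow> real) \<Rightarrow> (complex \<Rightarrow> complex) set" where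
  "weighted_H2 \<omega> =
     {g. g holomorphic_on ball 0 1 \<and>
         summable (\<lambda>k. (norm (fps_nth (fps_expansion g 0) k))\<^sup>2 * \<omega> k)}"

definition weighted_H2_norm :: "(nat \<Rightarrow> real) \<Rightarrow> (complex \<Rightarrow> complex) \<Rightarrow> real" where
  "weighted_H2_norm \<omega> g =
     sqrt (\<Sum>k. (norm (fps_nth (fps_expansion g 0) k))\<^sup>2 * \<omega> k)"

definition optimal_approximant ::
    "(nat \<Rightarrow> real) \<Rightarrow> (complex \<Rightarrow> complex) \<Rightarrow> nat \<Rightarrow> complex poly \<Rightarrow> bool" where
  "optimal_approximant \<omega> f n p \<longleftrightarrow>
     f \<in> weighted_H2 \<omega> \<and> (\<exists>z\<in>ball 0 1. f z \<noteq> 0) \<and>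
     degree p \<le> n \<and>
     (\<forall>q. degree q \<le> n \<longrightarrow>
        weighted_H2_norm \<omega> (\<lambda>z. 1 - poly p z * f z)
          \<le> weighted_H2_norm \<omega> (\<lambda>z. 1 - poly q z * f z))"

text \<open>
  Polynomials belong to the space for every weight, so for a nonzero polynomial \<open>f\<close> the
  first line in the definition above holds automatically.
\<close>

lemma higher_deriv_poly: "(deriv ^^ k) (poly f) = poly ((pderiv ^^ k) f)"
  for f :: "complex poly"
proof (induction k)
  case (Suc k)
  have "deriv (poly g) = poly (pderiv g)" for g :: "complex poly"
    by (rule ext) (rule DERIV_imp_deriv[OF poly_DERIV])
  with Suc show ?case by simp
qed simp

lemma fps_expansion_poly: "fps_nth (fps_expansion (poly f) 0) k = coeff f k"
  for f :: "complex poly"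
proof -
  have "coeff ((pderiv ^^ k) g) 0 = fact k * coeff g k" for g :: "complex poly"
    by (induction k arbitrary: g) (simp_all add: funpow_Suc_right coeff_pderiv mult_ac
          del: funpow.simps(2))
  then show ?thesis
    by (simp add: fps_expansion_def higher_deriv_poly poly_0_coeff_0)
qed

lemma poly_in_weighted_H2: "poly f \<in> weighted_H2 \<omega>"
  by (auto simp: weighted_H2_def fps_expansion_poly le_degree
        intro!: holomorphic_intros summable_finite[where N = "{..degree f}"])

end

theory Submission
  imports Defs "HOL-Computational_Algebra.Fundamental_Theorem_Algebra"
begin

text \<open>
  Let \<open>f\<close> have degree \<open>d\<close> and zero set \<open>Z\<close>, and put \<open>N = n + d\<close>. The residual \<open>r = 1 - p\<^sub>n f\<close> has degree at
  most \<open>N\<close>, takes the value 1 on \<open>Z\<close>, and is orthogonal to all multiples \<open>q f\<close> with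
  \<open>deg q \<le> n\<close>, i.e. to all polynomials of degree at most \<open>N\<close> vanishing on \<open>Z\<close>. Hence for any
  polynomials \<open>L\<^sub>w\<close> of degree at most \<open>N\<close> that form a Lagrange basis on \<open>Z\<close>, testing \<open>r\<close> against
  the reproducing kernel \<open>k\<close> of the polynomials of degree at most \<open>N\<close> gives
  \<open>r(z) = (\<Sum>w\<in>Z. k(z,w) \<langle>r, L\<^sub>w\<rangle>)\<close>, and testing \<open>r\<close> against itself gives \<open>\<parallel>r\<parallel> \<le> (\<Sum>w\<in>Z. \<parallel>L\<^sub>w\<parallel>)\<close>.
  Multiplying a fixed Lagrange basis by the normalised kernels of degree \<open>n\<close> yields
  \<open>\<parallel>L\<^sub>w\<parallel>\<^sup>2 = O(1 / k(w,w))\<close>, so \<open>\<bar>r(z)\<bar>\<close> is bounded by a multiple of the sum over \<open>w \<in> Z\<close> of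
  \<open>\<bar>k(z,w)\<bar> / sqrt (k(1,1) k(w,w))\<close>. Each term tends to 0 uniformly: for \<open>\<bar>w\<bar> = 1\<close> by Abel
  summation, for \<open>\<bar>w\<bar> > 1\<close> because the terms of the kernel eventually grow geometrically; both
  cases use \<open>\<omega>\<^sub>N k(1,1) \<rightarrow> \<infinity>\<close>.
\<close>

section \<open>The weighted inner product on polynomials\<close>

definition weighted_inner :: "(nat \<Rightarrow> real) \<Rightarrow> nat \<Rightarrow> complex poly \<Rightarrow> complex poly \<Rightarrow> complex" where
  "weighted_inner \<omega> N g h = (\<Sum>k\<le>N. coeff g k * cnj (coeff h k) * of_real (\<omega> k))"

text \<open>Phrased through \<open>L2_set\<close> so that Cauchy-Schwarz and the triangle inequality
  are instances of the inequalities for \<open>L2_set\<close>.\<close>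

definition weighted_norm :: "(nat \<Rightarrow> real) \<Rightarrow> nat \<Rightarrow> complex poly \<Rightarrow> real" where
  "weighted_norm \<omega> N g = L2_set (\<lambda>k. cmod (coeff g k) * sqrt (\<omega> k)) {..N}"

text \<open>The reproducing kernel at \<open>w\<close> of the polynomials of degree at most \<open>N\<close>.\<close>

definition rep_kernel :: "(nat \<Rightarrow> real) \<Rightarrow> nat \<Rightarrow> complex \<Rightarrow> complex poly" where
  "rep_kernel \<omega> N w = (\<Sum>k\<le>N. monom (cnj w ^ k / of_real (\<omega> k)) k)"

text \<open>The diagonal value k(w,w) as a real number, which is also the squared norm of the kernel
  at w.\<close>

definition kernel_diag :: "(nat \<Rightarrow> real) \<Rightarrow> nat \<Rightarrow> complex \<Rightarrow> real" where
  "kernel_diag \<omega> N w = (\<Sum>k\<le>N. (cmod w ^ k)\<^sup>2 / \<omega> k)"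

lemma weighted_norm_nonneg: "0 \<le> weighted_norm \<omega> N g"
  by (simp add: weighted_norm_def)

lemma weighted_norm_power2:
  assumes "\<And>k. 0 < \<omega> k"
  shows "(weighted_norm \<omega> N g)\<^sup>2 = (\<Sum>k\<le>N. (cmod (coeff g k))\<^sup>2 * \<omega> k)"
  by (simp add: weighted_norm_def L2_set_def sum_nonneg power_mult_distrib less_imp_le[OF assms])

lemma weighted_inner_self:
  assumes "\<And>k. 0 < \<omega> k"
  shows "weighted_inner \<omega> N g g = of_real ((weighted_norm \<omega> N g)\<^sup>2)"
  by (simp add: weighted_inner_def weighted_norm_power2[OF assms] complex_norm_square[symmetric]
      flip: of_real_power)

lemma weighted_inner_sum_right:
  "weighted_inner \<omega> N g (\<Sum>i\<in>A. smult (c i) (h i)) = (\<Sum>i\<in>A. cnj (c i) * weighted_inner \<omega> N g (h i))"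
  unfolding weighted_inner_def coeff_sum cnj_sum sum_distrib_left sum_distrib_right coeff_smult
  by (subst sum.swap) (simp add: mult_ac)

lemma weighted_inner_diff_right:
  "weighted_inner \<omega> N g (h1 - h2) = weighted_inner \<omega> N g h1 - weighted_inner \<omega> N g h2"
  by (simp add: weighted_inner_def algebra_simps sum_subtractf)

lemma norm_weighted_inner_le:
  assumes "\<And>k. 0 < \<omega> k"
  shows "cmod (weighted_inner \<omega> N g h) \<le> weighted_norm \<omega> N g * weighted_norm \<omega> N h"
proof -
  have nn: "0 \<le> \<omega> k" for k
    using assms less_imp_le by blast
  have "cmod (weighted_inner \<omega> N g h) \<le> (\<Sum>k\<le>N. cmod (coeff g k * cnj (coeff h k) * of_real (\<omega> k)))"
    unfolding weighted_inner_def by (rule norm_sum)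
  also have "\<dots> = (\<Sum>k\<le>N. \<bar>cmod (coeff g k) * sqrt (\<omega> k)\<bar> * \<bar>cmod (coeff h k) * sqrt (\<omega> k)\<bar>)"
    using nn by (intro sum.cong refl) (simp add: norm_mult abs_mult mult_ac)
  also have "\<dots> \<le> weighted_norm \<omega> N g * weighted_norm \<omega> N h"
    unfolding weighted_norm_def by (rule L2_set_mult_ineq)
  finally show ?thesis .
qed

lemma weighted_norm_power2_diff_smult:
  assumes "\<And>k. 0 < \<omega> k"
  shows "(weighted_norm \<omega> N (r - smult t h))\<^sup>2
    = (weighted_norm \<omega> N r)\<^sup>2 - 2 * Re (cnj t * weighted_inner \<omega> N r h) + (cmod t)\<^sup>2 * (weighted_norm \<omega> N h)\<^sup>2"
proof -
  have "(cmod (a - t * b))\<^sup>2 * x = (cmod a)\<^sup>2 * x - 2 * Re (cnj t * (a * cnj b * of_real x))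
      + (cmod t)\<^sup>2 * ((cmod b)\<^sup>2 * x)" for a b :: complex and x :: real
    by (simp only: cmod_power2) (simp add: algebra_simps power2_eq_square)
  then show ?thesis
    by (simp add: weighted_norm_power2[OF assms] weighted_inner_def sum_distrib_left sum_subtractf sum.distrib
        del: times_complex.sel)
qed

text \<open>If c = \<langle>r,h\<rangle> were nonzero, moving r a short way along -c h would lower
  its norm: the first-order gain 2 s |c|^2 beats the second-order loss s^2 |c|^2 H, where H is the
  squared norm of h.\<close>

lemma weighted_inner_eq_0_if_minimal:
  assumes pos: "\<And>k. 0 < \<omega> k"
    and min: "\<And>t. weighted_norm \<omega> N r \<le> weighted_norm \<omega> N (r - smult t h)"
  shows "weighted_inner \<omega> N r h = 0"
proof (rule ccontr)
  define c where "c = weighted_inner \<omega> N r h"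
  define H where "H = (weighted_norm \<omega> N h)\<^sup>2"
  \<comment> \<open>This step size gives s H < 1 and stays meaningful when H = 0.\<close>
  define s where "s = 1 / (1 + H)"
  assume "weighted_inner \<omega> N r h \<noteq> 0"
  then have c: "(cmod c)\<^sup>2 > 0"
    by (simp add: c_def)
  have H: "H \<ge> 0"
    by (simp add: H_def)
  have s: "s > 0" "s * H < 1"
    using H by (auto simp: s_def divide_simps)
  have "(weighted_norm \<omega> N r)\<^sup>2 \<le> (weighted_norm \<omega> N (r - smult (of_real s * c) h))\<^sup>2"
    using min by (intro power_mono weighted_norm_nonneg)
  also have "\<dots> = (weighted_norm \<omega> N r)\<^sup>2 - 2 * (s * (cmod c)\<^sup>2) + s\<^sup>2 * (cmod c)\<^sup>2 * H"
  proof -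
    have "cnj (of_real s * c) * c = of_real (s * (cmod c)\<^sup>2)"
      using complex_norm_square[of c] by (simp add: mult_ac)
    moreover have "(cmod (of_real s * c))\<^sup>2 = s\<^sup>2 * (cmod c)\<^sup>2"
      by (simp add: norm_mult power_mult_distrib)
    ultimately show ?thesis
      unfolding weighted_norm_power2_diff_smult[OF pos] c_def[symmetric] H_def[symmetric]
      by (metis Re_complex_of_real)
  qed
  finally have "2 * (s * (cmod c)\<^sup>2) \<le> (s * (cmod c)\<^sup>2) * (s * H)"
    by (simp add: power2_eq_square mult_ac)
  moreover have "(s * (cmod c)\<^sup>2) * (s * H) < (s * (cmod c)\<^sup>2) * 1"
    using s c by (intro mult_strict_left_mono) auto
  moreover have "0 < s * (cmod c)\<^sup>2"
    using s c by simp
  ultimately show False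
    by linarith
qed

section \<open>The reproducing kernel\<close>

lemma coeff_rep_kernel:
  "coeff (rep_kernel \<omega> N w) k = (if k \<le> N then cnj w ^ k / of_real (\<omega> k) else 0)"
  by (simp add: rep_kernel_def coeff_sum)

lemma degree_rep_kernel_le: "degree (rep_kernel \<omega> N w) \<le> N"
  by (rule degree_le) (simp add: coeff_rep_kernel)

lemma poly_rep_kernel: "poly (rep_kernel \<omega> N w) z = (\<Sum>k\<le>N. (cnj w * z) ^ k / of_real (\<omega> k))"
  by (simp add: rep_kernel_def poly_sum poly_monom power_mult_distrib)

lemma cnj_poly_rep_kernel: "cnj (poly (rep_kernel \<omega> N w) z) = poly (rep_kernel \<omega> N z) w"
  by (simp add: poly_rep_kernel mult.commute)

lemma poly_rep_kernel_self: "poly (rep_kernel \<omega> N w) w = of_real (kernel_diag \<omega> N w)"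
proof -
  have "cnj w * w = of_real ((cmod w)\<^sup>2)"
    by (simp only: complex_norm_square mult.commute)
  then show ?thesis
    by (simp add: poly_rep_kernel kernel_diag_def power_mult[symmetric] mult.commute)
qed

text \<open>The division by \<open>\<omega> k\<close> in the kernel cancels the weight, and
  conjugation turns \<open>cnj w ^ k\<close> into \<open>w ^ k\<close>; the degree bound ensures
  that no coefficient of g is cut off.\<close>

lemma weighted_inner_rep_kernel:
  assumes "\<And>k. 0 < \<omega> k" "degree g \<le> N"
  shows "weighted_inner \<omega> N g (rep_kernel \<omega> N w) = poly g w"
proof -
  have "weighted_inner \<omega> N g (rep_kernel \<omega> N w) = (\<Sum>k\<le>N. coeff g k * w ^ k)"
    unfolding weighted_inner_def using assms(1)
    by (intro sum.cong refl) (simp add: coeff_rep_kernel less_imp_neq[symmetric])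
  also have "\<dots> = poly g w"
    unfolding poly_altdef using assms(2)
    by (intro sum.mono_neutral_right) (auto simp: coeff_eq_0)
  finally show ?thesis .
qed

lemma kernel_diag_pos:
  assumes "\<And>k. 0 < \<omega> k"
  shows "0 < kernel_diag \<omega> N w"
proof -
  have "0 < (cmod w ^ 0)\<^sup>2 / \<omega> 0"
    using assms by simp
  also have "\<dots> \<le> kernel_diag \<omega> N w"
    unfolding kernel_diag_def
    by (intro member_le_sum) (auto simp: less_imp_le[OF assms])
  finally show ?thesis .
qed

lemma weighted_norm_power2_rep_kernel:
  assumes "\<And>k. 0 < \<omega> k"
  shows "(weighted_norm \<omega> N (rep_kernel \<omega> N w))\<^sup>2 = kernel_diag \<omega> N w"
  using weighted_inner_rep_kernel[where \<omega> = \<omega> and w = w, OF assms degree_rep_kernel_le[of \<omega> N w]]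
  unfolding poly_rep_kernel_self weighted_inner_self[OF assms] by (simp only: of_real_eq_iff)

section \<open>Norm comparisons uniform in the degree\<close>

lemma weighted_norm_truncation:
  assumes "degree g \<le> M" "M \<le> N"
  shows "weighted_norm \<omega> N g = weighted_norm \<omega> M g"
  unfolding weighted_norm_def L2_set_def using assms
  by (intro arg_cong[where f = sqrt] sum.mono_neutral_right) (auto simp: coeff_eq_0)

text \<open>Multiplication by the variable shifts coefficients and so costs at most a factor B in
  the squared norm; induction over the coefficients of l, as in Horner's scheme, handles a general
  multiplier. The constant depends on l but not on N or g. Coefficients shifted beyond N are dropped
  by the truncated norm, which only helps.\<close>

lemma weighted_norm_mult_le:
  assumes pos: "\<And>k. 0 < \<omega> k" and shift: "\<And>k. \<omega> (Suc k) \<le> B * \<omega> k"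
  shows "\<exists>C. \<forall>N g. (weighted_norm \<omega> N (l * g))\<^sup>2 \<le> C * (weighted_norm \<omega> N g)\<^sup>2"
proof (induction l)
  case 0
  have "(weighted_norm \<omega> N (0 * g))\<^sup>2 \<le> 0 * (weighted_norm \<omega> N g)\<^sup>2" for N g
    by (simp add: weighted_norm_power2[OF pos])
  then show ?case by blast
next
  case (pCons a l)
  then obtain C where C: "\<And>N g. (weighted_norm \<omega> N (l * g))\<^sup>2 \<le> C * (weighted_norm \<omega> N g)\<^sup>2"
    by blast
  have "0 < B * \<omega> 0"
    using pos[of 1] shift[of 0] by simp
  then have B: "0 < B"
    using pos[of 0] by (simp add: zero_less_mult_iff)
  have smult: "(weighted_norm \<omega> N (smult a g))\<^sup>2 = (cmod a)\<^sup>2 * (weighted_norm \<omega> N g)\<^sup>2" for N g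
    by (simp add: weighted_norm_power2[OF pos] norm_mult power_mult_distrib sum_distrib_left mult.assoc)
  have shifted: "(weighted_norm \<omega> N (pCons 0 h))\<^sup>2 \<le> B * (weighted_norm \<omega> N h)\<^sup>2" for N h
  proof -
    have "(weighted_norm \<omega> N (pCons 0 h))\<^sup>2 = (\<Sum>k<N. (cmod (coeff h k))\<^sup>2 * \<omega> (Suc k))"
      unfolding weighted_norm_power2[OF pos] by (subst sum.atMost_shift) simp
    also have "\<dots> \<le> (\<Sum>k<N. (cmod (coeff h k))\<^sup>2 * (B * \<omega> k))"
      using shift by (intro sum_mono mult_left_mono) auto
    also have "\<dots> \<le> (\<Sum>k\<le>N. (cmod (coeff h k))\<^sup>2 * (B * \<omega> k))"
      using B by (intro sum_mono2) (auto simp: less_imp_le[OF pos])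
    also have "\<dots> = B * (weighted_norm \<omega> N h)\<^sup>2"
      by (simp add: weighted_norm_power2[OF pos] sum_distrib_left mult_ac)
    finally show ?thesis .
  qed
  have add: "(weighted_norm \<omega> N (u + v))\<^sup>2 \<le> 2 * (weighted_norm \<omega> N u)\<^sup>2 + 2 * (weighted_norm \<omega> N v)\<^sup>2" for N u v
  proof -
    have "weighted_norm \<omega> N (u + v)
        \<le> L2_set (\<lambda>k. cmod (coeff u k) * sqrt (\<omega> k) + cmod (coeff v k) * sqrt (\<omega> k)) {..N}"
      unfolding weighted_norm_def
      by (intro L2_set_mono)
        (auto simp: less_imp_le[OF pos] norm_triangle_ineq mult_right_mono simp flip: distrib_right)
    also have "\<dots> \<le> weighted_norm \<omega> N u + weighted_norm \<omega> N v"
      unfolding weighted_norm_def by (rule L2_set_triangle_ineq)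
    finally have "(weighted_norm \<omega> N (u + v))\<^sup>2 \<le> (weighted_norm \<omega> N u + weighted_norm \<omega> N v)\<^sup>2"
      by (intro power_mono weighted_norm_nonneg)
    also have "\<dots> \<le> 2 * (weighted_norm \<omega> N u)\<^sup>2 + 2 * (weighted_norm \<omega> N v)\<^sup>2"
      using sum_squares_bound[of "weighted_norm \<omega> N u" "weighted_norm \<omega> N v"] by (simp add: power2_sum)
    finally show ?thesis .
  qed
  have "(weighted_norm \<omega> N (pCons a l * g))\<^sup>2 \<le> (2 * (cmod a)\<^sup>2 + 2 * (B * C)) * (weighted_norm \<omega> N g)\<^sup>2" for N g
  proof -
    have "B * (weighted_norm \<omega> N (l * g))\<^sup>2 \<le> B * (C * (weighted_norm \<omega> N g)\<^sup>2)"
      using B C by (intro mult_left_mono) auto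
    then show ?thesis
      using add[of N "smult a g" "pCons 0 (l * g)"] smult[of N g] shifted[of N "l * g"]
      by (simp add: algebra_simps)
  qed
  then show ?case by blast
qed

text \<open>Each new term of the sum is at most B |w|^2 times the one before it, so one more degree
  multiplies the sum by at most 1 + B |w|^2. This compares the levels n and n + d at the price of a
  constant.\<close>

lemma kernel_diag_add_le:
  assumes pos: "\<And>k. 0 < \<omega> k" and shift: "\<And>k. \<omega> k \<le> B * \<omega> (Suc k)"
  shows "\<exists>C>0. \<forall>n. kernel_diag \<omega> (n + d) w \<le> C * kernel_diag \<omega> n w"
proof (induction d)
  case 0
  then show ?case by (intro exI[of _ 1]) simp
next
  case (Suc d)
  then obtain C where C: "C > 0" "\<And>n. kernel_diag \<omega> (n + d) w \<le> C * kernel_diag \<omega> n w"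
    by blast
  define D where "D = 1 + B * (cmod w)\<^sup>2"
  have "0 < B * \<omega> 1"
    using pos[of 0] shift[of 0] by simp
  then have B: "0 < B"
    using pos[of 1] by (simp add: zero_less_mult_iff)
  have D: "D > 0"
    using B by (simp add: D_def add_pos_nonneg)
  have step: "kernel_diag \<omega> (Suc n) w \<le> D * kernel_diag \<omega> n w" for n
  proof -
    have *: "1 / \<omega> (Suc n) \<le> B / \<omega> n"
      using pos[of n] pos[of "Suc n"] shift[of n] by (simp add: field_simps)
    have "(cmod w ^ Suc n)\<^sup>2 / \<omega> (Suc n) = (cmod w)\<^sup>2 * (cmod w ^ n)\<^sup>2 * (1 / \<omega> (Suc n))"
      by (simp add: power_mult_distrib)
    also have "\<dots> \<le> (cmod w)\<^sup>2 * (cmod w ^ n)\<^sup>2 * (B / \<omega> n)"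
      using * by (intro mult_left_mono) auto
    also have "\<dots> = B * (cmod w)\<^sup>2 * ((cmod w ^ n)\<^sup>2 / \<omega> n)"
      by simp
    also have "\<dots> \<le> B * (cmod w)\<^sup>2 * kernel_diag \<omega> n w"
      unfolding kernel_diag_def using B
      by (intro mult_left_mono member_le_sum) (auto simp: less_imp_le[OF pos])
    finally show ?thesis
      by (simp add: kernel_diag_def D_def algebra_simps)
  qed
  have "kernel_diag \<omega> (n + Suc d) w \<le> (D * C) * kernel_diag \<omega> n w" for n
  proof -
    have "kernel_diag \<omega> (n + Suc d) w \<le> D * kernel_diag \<omega> (n + d) w"
      using step[of "n + d"] by simp
    also have "\<dots> \<le> D * (C * kernel_diag \<omega> n w)"
      using C D by (intro mult_left_mono) auto
    finally show ?thesis by simp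
  qed
  then show ?case
    using C D by (intro exI[of _ "D * C"]) simp
qed

text \<open>Links the norm in the definition of optimality to the finite sums used here.\<close>

lemma weighted_H2_norm_poly:
  assumes pos: "\<And>k. 0 < \<omega> k" and "degree g \<le> N"
  shows "weighted_H2_norm \<omega> (poly g) = weighted_norm \<omega> N g"
proof -
  have "(\<Sum>k. (cmod (coeff g k))\<^sup>2 * \<omega> k) = (\<Sum>k\<le>N. (cmod (coeff g k))\<^sup>2 * \<omega> k)"
    using assms(2) by (intro suminf_finite) (auto simp: coeff_eq_0)
  then show ?thesis
    using weighted_norm_power2[of \<omega> N g, OF pos, symmetric] weighted_norm_nonneg[of \<omega> N g]
    by (simp add: weighted_H2_norm_def fps_expansion_poly)
qed

section \<open>Divisibility and interpolation at simple zeros\<close>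

lemma prod_linear_factors_dvd:
  fixes g :: "'a :: idom poly"
  assumes "finite A" "\<And>a. a \<in> A \<Longrightarrow> poly g a = 0"
  shows "(\<Prod>a\<in>A. [:-a, 1:]) dvd g"
  using assms
proof (induction A arbitrary: g rule: finite_induct)
  case (insert a A)
  then obtain h where h: "g = [:-a, 1:] * h"
    by (metis dvdE insertI1 poly_eq_0_iff_dvd)
  have "poly h b = 0" if "b \<in> A" for b
    using insert.prems[of b] insert.hyps(2) that h by auto
  then have "(\<Prod>a\<in>A. [:-a, 1:]) dvd h"
    by (rule insert.IH)
  then show ?case
    using insert.hyps h by (simp add: mult_dvd_mono del: mult_pCons_left)
qed simp

text \<open>Simplicity of the zeros makes f a scalar multiple of the product of the linear factors
  over its distinct zeros.\<close>

lemma rsquarefree_dvd_if_roots: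
  fixes f g :: "complex poly"
  assumes "rsquarefree f" "\<And>z. poly f z = 0 \<Longrightarrow> poly g z = 0"
  shows "f dvd g"
proof -
  have "f \<noteq> 0"
    using assms(1) by (simp add: rsquarefree_def)
  then have "(\<Prod>z | poly f z = 0. [:-z, 1:]) dvd g"
    using assms(2) by (intro prod_linear_factors_dvd poly_roots_finite) auto
  then have "smult (lead_coeff f) (\<Prod>z | poly f z = 0. [:-z, 1:]) dvd g"
    using \<open>f \<noteq> 0\<close> by (simp add: smult_dvd)
  then show ?thesis
    by (simp only: complex_poly_decompose_rsquarefree[OF assms(1)])
qed

text \<open>The quotient of f by the linear factor at w vanishes at all other zeros, and not at w
  because that zero is simple; it only has to be normalised.\<close>

lemma lagrange_basis_exists:
  fixes f :: "complex poly"
  assumes "rsquarefree f" "poly f w = 0"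
  shows "\<exists>l. degree l \<le> degree f \<and> poly l w = 1 \<and> (\<forall>z. poly f z = 0 \<longrightarrow> z \<noteq> w \<longrightarrow> poly l z = 0)"
proof -
  from assms(2) obtain g where g: "f = [:-w, 1:] * g"
    by (metis dvdE poly_eq_0_iff_dvd)
  have "f \<noteq> 0"
    using assms(1) by (simp add: rsquarefree_def)
  have "poly g w \<noteq> 0"
  proof
    assume "poly g w = 0"
    then have "[:-w, 1:] ^ 2 dvd f"
      unfolding g power2_eq_square by (intro mult_dvd_mono) (simp_all add: poly_eq_0_iff_dvd)
    then show False
      using assms \<open>f \<noteq> 0\<close> by (simp add: order_divides rsquarefree_root_order)
  qed
  moreover have "degree g \<le> degree f"
    using g \<open>f \<noteq> 0\<close> by (intro dvd_imp_degree_le) (auto simp del: mult_pCons_left)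
  ultimately show ?thesis
    using g by (intro exI[of _ "smult (1 / poly g w) g"]) auto
qed

section \<open>Bounding the residual by normalised kernels\<close>

lemma residual_bound:
  fixes f :: "complex poly" and p :: "nat \<Rightarrow> complex poly"
  assumes pos: "\<And>k. 0 < \<omega> k"
    and up: "\<And>k. \<omega> (Suc k) \<le> B * \<omega> k" and down: "\<And>k. \<omega> k \<le> B * \<omega> (Suc k)"
    and sf: "rsquarefree f" and roots: "\<And>z. poly f z = 0 \<Longrightarrow> 1 \<le> cmod z"
    and opt: "\<And>n. optimal_approximant \<omega> (poly f) n (p n)"
  shows "\<exists>C. \<forall>n z. cmod (1 - poly (p n) z * poly f z)
    \<le> C * (\<Sum>w | poly f w = 0. cmod (poly (rep_kernel \<omega> (n + degree f) w) z) /
        sqrt (kernel_diag \<omega> (n + degree f) 1 * kernel_diag \<omega> (n + degree f) w))"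
proof -
  define Z where "Z = {z. poly f z = 0}"
  define d where "d = degree f"
  have f0: "f \<noteq> 0"
    using sf by (simp add: rsquarefree_def)
  have Z: "finite Z"
    using f0 by (simp add: Z_def poly_roots_finite)
  have "\<exists>l. \<forall>w\<in>Z. degree (l w) \<le> d \<and> poly (l w) w = 1 \<and> (\<forall>z\<in>Z. z \<noteq> w \<longrightarrow> poly (l w) z = 0)"
    using lagrange_basis_exists[OF sf] unfolding Z_def d_def by (intro bchoice) blast
  then obtain l where l: "\<And>w. w \<in> Z \<Longrightarrow> degree (l w) \<le> d" "\<And>w. w \<in> Z \<Longrightarrow> poly (l w) w = 1"
    "\<And>w z. w \<in> Z \<Longrightarrow> z \<in> Z \<Longrightarrow> z \<noteq> w \<Longrightarrow> poly (l w) z = 0"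
    by blast
  have "\<exists>M. \<forall>w N g. (weighted_norm \<omega> N (l w * g))\<^sup>2 \<le> M w * (weighted_norm \<omega> N g)\<^sup>2"
    by (intro choice allI weighted_norm_mult_le[of \<omega> B, OF pos up])
  then obtain M where M: "\<And>w N g. (weighted_norm \<omega> N (l w * g))\<^sup>2 \<le> M w * (weighted_norm \<omega> N g)\<^sup>2"
    by blast
  have "\<exists>C. \<forall>w. C w > 0 \<and> (\<forall>n. kernel_diag \<omega> (n + d) w \<le> C w * kernel_diag \<omega> n w)"
    by (intro choice allI kernel_diag_add_le[of \<omega> B, OF pos down])
  then obtain C where C: "\<And>w. C w > 0" "\<And>w n. kernel_diag \<omega> (n + d) w \<le> C w * kernel_diag \<omega> n w"
    by blast
  \<comment> \<open>\<open>M w\<close> pays for multiplication by \<open>l w\<close> and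
    \<open>C w\<close> for passing from level n to level n + d. The absolute value is there because
    the sign of \<open>M w\<close> is not recorded.\<close>
  define D where "D w = sqrt (\<bar>M w\<bar> * C w)" for w
  define E where "E = sum D Z"
  have D: "0 \<le> D w" for w
    using C(1)[of w] by (simp add: D_def)
  have D_le_E: "D w \<le> E" if "w \<in> Z" for w
    unfolding E_def using that Z D by (intro member_le_sum) auto
  have E: "0 \<le> E"
    unfolding E_def using D by (intro sum_nonneg) auto
  have "cmod (1 - poly (p n) z * poly f z)
    \<le> E\<^sup>2 * (\<Sum>w\<in>Z. cmod (poly (rep_kernel \<omega> (n + d) w) z) /
        sqrt (kernel_diag \<omega> (n + d) 1 * kernel_diag \<omega> (n + d) w))" for n z
  proof -
    define N where "N = n + d"
    define S where "S = kernel_diag \<omega> N"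
    define r where "r = 1 - p n * f"
    \<comment> \<open>The kernel is taken at level n, not N, so that the product with
      \<open>l w\<close> still has degree at most N. Dividing by the diagonal value makes the kernel
      equal to 1 at w.\<close>
    define L where "L w = smult (1 / of_real (kernel_diag \<omega> n w)) (l w * rep_kernel \<omega> n w)" for w
    have S: "0 < S w" for w
      unfolding S_def by (rule kernel_diag_pos[OF pos])
    have deg_mult: "degree (q * f) \<le> N" if "degree q \<le> n" for q
      using that degree_mult_le[of q f] by (simp add: N_def d_def)
    have deg_p: "degree (p n) \<le> n"
      using opt[of n] by (simp add: optimal_approximant_def)
    have deg_res: "degree (1 - q * f) \<le> N" if "degree q \<le> n" for q
      using deg_mult[OF that] by (intro degree_diff_le) auto
    have norm_res: "weighted_H2_norm \<omega> (\<lambda>z. 1 - poly q z * poly f z) = weighted_norm \<omega> N (1 - q * f)"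
      if "degree q \<le> n" for q
    proof -
      have "(\<lambda>z. 1 - poly q z * poly f z) = poly (1 - q * f)"
        by (simp add: fun_eq_iff)
      then show ?thesis
        using weighted_H2_norm_poly[of \<omega>, OF pos deg_res[OF that]] by simp
    qed
    \<comment> \<open>Subtracting t f q from r yields the residual of the competitor
      \<open>p n + smult t q\<close>, so optimality supplies the minimality hypothesis.\<close>
    have orth: "weighted_inner \<omega> N r (f * q) = 0" if "degree q \<le> n" for q
    proof (rule weighted_inner_eq_0_if_minimal[OF pos])
      fix t
      have deg: "degree (p n + smult t q) \<le> n"
        using deg_p that by (intro degree_add_le) (auto intro: order_trans[OF degree_smult_le])
      have "r - smult t (f * q) = 1 - (p n + smult t q) * f"
        by (simp add: r_def algebra_simps)
      moreover have "weighted_H2_norm \<omega> (\<lambda>z. 1 - poly (p n) z * poly f z)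
          \<le> weighted_H2_norm \<omega> (\<lambda>z. 1 - poly (p n + smult t q) z * poly f z)"
        using opt[of n] deg unfolding optimal_approximant_def by blast
      ultimately show "weighted_norm \<omega> N r \<le> weighted_norm \<omega> N (r - smult t (f * q))"
        unfolding norm_res[OF deg] norm_res[OF deg_p] by (simp only: r_def)
    qed
    have deg_L: "degree (L w) \<le> N" if "w \<in> Z" for w
      using degree_mult_le[of "l w" "rep_kernel \<omega> n w"] l(1)[OF that] degree_rep_kernel_le[of \<omega> n w]
      unfolding L_def N_def by (intro order_trans[OF degree_smult_le]) linarith
    have L_root: "poly (L w) z = (if z = w then 1 else 0)" if "w \<in> Z" "z \<in> Z" for w z
      using that l kernel_diag_pos[of \<omega> n w, OF pos] by (auto simp: L_def poly_rep_kernel_self)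
    \<comment> \<open>The difference of g and its Lagrange interpolant vanishes on Z, hence is f q
      with q of degree at most n, hence is orthogonal to r.\<close>
    have expand: "weighted_inner \<omega> N r g = (\<Sum>w\<in>Z. cnj (poly g w) * weighted_inner \<omega> N r (L w))"
      if "degree g \<le> N" for g
    proof -
      define h where "h = g - (\<Sum>w\<in>Z. smult (poly g w) (L w))"
      have "poly h z = 0" if "z \<in> Z" for z
        using that Z by (simp add: h_def poly_sum L_root sum.delta if_distrib cong: if_cong)
      then have "f dvd h"
        using sf by (intro rsquarefree_dvd_if_roots) (auto simp: Z_def)
      then obtain q where q: "h = f * q" ..
      have "degree h \<le> N"
        unfolding h_def using that deg_L
        by (intro degree_diff_le degree_sum_le Z) (auto intro: order_trans[OF degree_smult_le])
      then have "degree q \<le> n"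
        using f0 by (cases "q = 0") (auto simp: q degree_mult_eq N_def d_def)
      then have "weighted_inner \<omega> N r h = 0"
        unfolding q by (rule orth)
      then show ?thesis
        unfolding h_def weighted_inner_diff_right weighted_inner_sum_right by simp
    qed
    \<comment> \<open>With s the squared norm of the kernel at level n, the squared norm of
      \<open>L w\<close> is at most |M w| s / s^2 = |M w| / s, and 1 / s is at most C w / S
      w.\<close>
    have norm_L: "weighted_norm \<omega> N (L w) \<le> D w / sqrt (S w)" for w
    proof -
      define s where "s = kernel_diag \<omega> n w"
      have s: "s > 0"
        unfolding s_def by (rule kernel_diag_pos[OF pos])
      have "(weighted_norm \<omega> N (L w))\<^sup>2 = (weighted_norm \<omega> N (l w * rep_kernel \<omega> n w))\<^sup>2 / s\<^sup>2"
        by (simp add: L_def weighted_norm_power2[OF pos] norm_mult norm_divide power_mult_distrib power_divide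
            sum_divide_distrib flip: s_def)
      also have "\<dots> \<le> \<bar>M w\<bar> * s / s\<^sup>2"
      proof -
        have "(weighted_norm \<omega> N (rep_kernel \<omega> n w))\<^sup>2 = s"
          using weighted_norm_truncation[OF degree_rep_kernel_le, of n N \<omega> \<omega> w] weighted_norm_power2_rep_kernel[of \<omega> n w, OF pos]
          by (simp add: N_def s_def)
        then have "(weighted_norm \<omega> N (l w * rep_kernel \<omega> n w))\<^sup>2 \<le> M w * s"
          using M[of N w "rep_kernel \<omega> n w"] by simp
        also have "\<dots> \<le> \<bar>M w\<bar> * s"
          using s by (intro mult_right_mono) auto
        finally show ?thesis
          by (intro divide_right_mono) auto
      qed
      also have "\<dots> = \<bar>M w\<bar> * (1 / s)"
        using s by (simp add: power2_eq_square)
      also have "\<dots> \<le> \<bar>M w\<bar> * (C w / S w)"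
        using C(2)[of n w] s S[of w] by (intro mult_left_mono) (auto simp: field_simps S_def N_def s_def)
      finally have "sqrt ((weighted_norm \<omega> N (L w))\<^sup>2) \<le> sqrt (\<bar>M w\<bar> * (C w / S w))"
        by (rule real_sqrt_le_mono)
      then show ?thesis
        by (simp add: weighted_norm_nonneg D_def real_sqrt_divide[symmetric])
    qed
    \<comment> \<open>All zeros satisfy |w| \<ge> 1, so each summand grows when 1 is replaced by
      w.\<close>
    have S1: "S 1 \<le> S w" if "w \<in> Z" for w
      unfolding S_def kernel_diag_def using roots[of w] that
      by (intro sum_mono divide_right_mono)
        (auto simp: Z_def less_imp_le[OF pos] intro: one_le_power)
    \<comment> \<open>Apply \<open>expand\<close> to r itself, whose values on Z are all 1, bound
      each pairing by Cauchy-Schwarz, and cancel one factor of the norm of r.\<close>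
    have norm_r: "weighted_norm \<omega> N r \<le> E / sqrt (S 1)"
    proof -
      have "weighted_norm \<omega> N r * weighted_norm \<omega> N r = cmod (weighted_inner \<omega> N r r)"
        by (simp add: weighted_inner_self[OF pos] norm_power power2_eq_square norm_mult)
      also have "weighted_inner \<omega> N r r = (\<Sum>w\<in>Z. weighted_inner \<omega> N r (L w))"
        using deg_res[OF deg_p] unfolding r_def[symmetric]
        by (subst expand) (auto simp: r_def Z_def)
      also have "cmod \<dots> \<le> (\<Sum>w\<in>Z. weighted_norm \<omega> N r * (D w / sqrt (S 1)))"
      proof (rule sum_norm_le)
        fix w assume w: "w \<in> Z"
        have "cmod (weighted_inner \<omega> N r (L w)) \<le> weighted_norm \<omega> N r * weighted_norm \<omega> N (L w)"
          by (rule norm_weighted_inner_le[OF pos])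
        also have "\<dots> \<le> weighted_norm \<omega> N r * (D w / sqrt (S w))"
          by (intro mult_left_mono norm_L weighted_norm_nonneg)
        also have "\<dots> \<le> weighted_norm \<omega> N r * (D w / sqrt (S 1))"
          using S1[OF w] S[of 1] D[of w]
          by (intro mult_left_mono divide_left_mono weighted_norm_nonneg) auto
        finally show "cmod (weighted_inner \<omega> N r (L w)) \<le> weighted_norm \<omega> N r * (D w / sqrt (S 1))" .
      qed
      also have "\<dots> = weighted_norm \<omega> N r * (E / sqrt (S 1))"
        by (simp add: E_def sum_distrib_left sum_divide_distrib)
      finally have *: "weighted_norm \<omega> N r * weighted_norm \<omega> N r \<le> weighted_norm \<omega> N r * (E / sqrt (S 1))" .
      show ?thesis
      proof (cases "weighted_norm \<omega> N r = 0")
        case True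
        then show ?thesis
          using E S[of 1] by simp
      next
        case False
        then show ?thesis
          using * weighted_norm_nonneg[of \<omega> N r] by (intro mult_left_le_imp_le[OF *]) simp
      qed
    qed
    \<comment> \<open>Evaluation at z is pairing with the kernel at z. Expanding that kernel over Z
      produces its conjugated values at w, which by Hermitian symmetry are the values at z of the
      kernels at w.\<close>
    have "1 - poly (p n) z * poly f z = weighted_inner \<omega> N r (rep_kernel \<omega> N z)"
      using weighted_inner_rep_kernel[OF pos deg_res[OF deg_p]] by (simp add: r_def)
    also have "\<dots> = (\<Sum>w\<in>Z. poly (rep_kernel \<omega> N w) z * weighted_inner \<omega> N r (L w))"
      by (simp add: expand[OF degree_rep_kernel_le] cnj_poly_rep_kernel)
    also have "cmod \<dots> \<le> (\<Sum>w\<in>Z. cmod (poly (rep_kernel \<omega> N w) z) * (E / sqrt (S 1) * (E / sqrt (S w))))"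
    proof (rule sum_norm_le)
      fix w assume w: "w \<in> Z"
      have "cmod (weighted_inner \<omega> N r (L w)) \<le> weighted_norm \<omega> N r * weighted_norm \<omega> N (L w)"
        by (rule norm_weighted_inner_le[OF pos])
      also have "\<dots> \<le> E / sqrt (S 1) * (D w / sqrt (S w))"
        using E S[of 1] by (intro mult_mono norm_L norm_r weighted_norm_nonneg) auto
      also have "\<dots> \<le> E / sqrt (S 1) * (E / sqrt (S w))"
        using E S[of 1] S[of w] D_le_E[OF w] by (intro mult_left_mono divide_right_mono) auto
      finally show "cmod (poly (rep_kernel \<omega> N w) z * weighted_inner \<omega> N r (L w))
          \<le> cmod (poly (rep_kernel \<omega> N w) z) * (E / sqrt (S 1) * (E / sqrt (S w)))"
        unfolding norm_mult by (intro mult_left_mono) auto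
    qed
    also have "\<dots> = E\<^sup>2 * (\<Sum>w\<in>Z. cmod (poly (rep_kernel \<omega> N w) z) / sqrt (S 1 * S w))"
      by (simp add: sum_distrib_left power2_eq_square real_sqrt_mult mult_ac)
    finally show ?thesis
      by (simp add: N_def S_def)
  qed
  then show ?thesis
    unfolding Z_def d_def by blast
qed


section \<open>Asymptotics of weights\<close>

lemma weight_pos: "weight \<omega> \<Longrightarrow> 0 < \<omega> k"
  by (simp add: weight_def)

text \<open>By monotonicity the ratio of consecutive weights lies between 1 and the ratio over a
  window of length about sqrt(n), which tends to 1 by the definition of a weight.\<close>

lemma weight_ratio_tendsto:
  assumes "weight \<omega>"
  shows "(\<lambda>n. \<omega> (Suc n) / \<omega> n) \<longlonglongrightarrow> 1"
proof -
  define m where "m n = n - nat \<lfloor>sqrt (real n)\<rfloor>" for n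
  \<comment> \<open>The index \<open>Suc n\<close> guarantees that the window has length at least
    1.\<close>
  have m: "m (Suc n) \<le> n" for n
  proof -
    have "1 \<le> nat \<lfloor>sqrt (real (Suc n))\<rfloor>"
      by (simp add: le_nat_floor)
    then show ?thesis
      unfolding m_def by linarith
  qed
  have lim: "(\<lambda>n. \<omega> (Suc n) / \<omega> (m (Suc n))) \<longlonglongrightarrow> 1"
    using assms LIMSEQ_Suc[of "\<lambda>n. \<omega> n / \<omega> (m n)"] by (simp add: weight_def m_def)
  note pos = weight_pos[OF assms]
  consider "mono \<omega>" | "antimono \<omega>"
    using assms by (auto simp: weight_def)
  then show ?thesis
  proof cases
    case 1
    have "1 \<le> \<omega> (Suc n) / \<omega> n" for n
      using monoD[OF 1, of n "Suc n"] pos by simp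
    moreover have "\<omega> (Suc n) / \<omega> n \<le> \<omega> (Suc n) / \<omega> (m (Suc n))" for n
      using monoD[OF 1 m, of n] by (intro divide_left_mono mult_pos_pos pos less_imp_le[OF pos])
    ultimately show ?thesis
      by (intro tendsto_sandwich[OF _ _ tendsto_const lim] always_eventually allI)
  next
    case 2
    have "\<omega> (Suc n) / \<omega> n \<le> 1" for n
      using antimonoD[OF 2, of n "Suc n"] pos by simp
    moreover have "\<omega> (Suc n) / \<omega> (m (Suc n)) \<le> \<omega> (Suc n) / \<omega> n" for n
      using antimonoD[OF 2 m, of n] by (intro divide_left_mono divide_right_mono mult_pos_pos pos less_imp_le[OF pos])
    ultimately show ?thesis
      by (intro tendsto_sandwich[OF _ _ lim tendsto_const] always_eventually allI)
  qed
qed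

lemma weight_ratio_bounded:
  assumes "weight \<omega>"
  shows "\<exists>B. (\<forall>k. \<omega> (Suc k) \<le> B * \<omega> k) \<and> (\<forall>k. \<omega> k \<le> B * \<omega> (Suc k))"
proof -
  note pos = weight_pos[OF assms]
  note lim = weight_ratio_tendsto[OF assms]
  have lim': "(\<lambda>n. \<omega> n / \<omega> (Suc n)) \<longlonglongrightarrow> 1"
    using tendsto_inverse[OF lim] by simp
  obtain B1 where B1: "\<And>n. norm (\<omega> (Suc n) / \<omega> n) \<le> B1"
    using convergent_imp_Bseq[OF convergentI[OF lim]] unfolding Bseq_def by blast
  obtain B2 where B2: "\<And>n. norm (\<omega> n / \<omega> (Suc n)) \<le> B2"
    using convergent_imp_Bseq[OF convergentI[OF lim']] unfolding Bseq_def by blast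
  have "\<omega> (Suc n) \<le> B1 * \<omega> n" "\<omega> n \<le> B2 * \<omega> (Suc n)" for n
    using B1[of n] B2[of n] pos[of n] pos[of "Suc n"] by (auto simp: field_simps)
  moreover have "B1 * \<omega> n \<le> max B1 B2 * \<omega> n" "B2 * \<omega> n \<le> max B1 B2 * \<omega> n" for n
    using pos[of n] by auto
  ultimately show ?thesis
    by (intro exI[of _ "max B1 B2"] conjI allI) (meson order_trans)+
qed

lemma weight_kernel_diag_1_at_top:
  assumes "weight \<omega>"
  shows "filterlim (\<lambda>N. kernel_diag \<omega> N 1) at_top sequentially"
proof (rule filterlim_at_top_mono)
  show "filterlim (\<lambda>n. \<Sum>k=1..n. 1 / \<omega> k) at_top sequentially"
    using assms by (simp add: weight_def)
  show "\<forall>\<^sub>F N in sequentially. (\<Sum>k=1..N. 1 / \<omega> k) \<le> kernel_diag \<omega> N 1"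
    unfolding kernel_diag_def
    by (intro always_eventually allI)
      (auto intro!: sum_mono2 simp: less_imp_le[OF weight_pos[OF assms]])
qed

text \<open>For nondecreasing weights, \<open>\<omega> N\<close> is at least 1 and the diverging
  series suffices. For nonincreasing weights, the last terms of the sum, about sqrt(n) many, are
  each at least \<open>1 / \<omega> (n - s n)\<close>, and
  \<open>\<omega> n / \<omega> (n - s n)\<close> tends to 1, so the product grows at least like
  sqrt(n).\<close>

lemma weight_mult_kernel_diag_1_at_top:
  assumes "weight \<omega>"
  shows "filterlim (\<lambda>N. \<omega> N * kernel_diag \<omega> N 1) at_top sequentially"
proof -
  note pos = weight_pos[OF assms]
  consider "mono \<omega>" | "antimono \<omega>"
    using assms by (auto simp: weight_def)
  then show ?thesis
  proof cases
    case 1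
    have "1 \<le> \<omega> N" for N
      using monoD[OF 1, of 0 N] assms by (simp add: weight_def)
    then have "kernel_diag \<omega> N 1 \<le> \<omega> N * kernel_diag \<omega> N 1" for N
      using kernel_diag_pos[of \<omega> N 1, OF pos] by simp
    then show ?thesis
      by (intro filterlim_at_top_mono[OF weight_kernel_diag_1_at_top[OF assms]]) simp
  next
    case 2
    define s where "s n = nat \<lfloor>sqrt (real n)\<rfloor>" for n
    have lim: "(\<lambda>n. \<omega> n / \<omega> (n - s n)) \<longlonglongrightarrow> 1"
      using assms by (simp add: weight_def s_def)
    have "filterlim (\<lambda>n. sqrt (real n)) at_top sequentially"
      by (intro filterlim_compose[OF sqrt_at_top] filterlim_real_sequentially)
    then have "filterlim (\<lambda>n. \<omega> n / \<omega> (n - s n) * sqrt (real n)) at_top sequentially"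
      by (intro filterlim_tendsto_pos_mult_at_top[OF lim]) auto
    then show ?thesis
    proof (rule filterlim_at_top_mono, intro always_eventually allI)
      fix n
      have "sqrt (real n) \<le> real n"
      proof (cases "n = 0")
        case False
        then show ?thesis
          by (intro real_le_lsqrt) (auto simp: power2_eq_square)
      qed simp
      then have "s n \<le> n"
        unfolding s_def by linarith
      \<comment> \<open>The closed window has \<open>s n + 1\<close> elements, which makes up for
        rounding the root down.\<close>
      then have "sqrt (real n) \<le> real (card {n - s n..n})"
        unfolding s_def by (simp add: Suc_diff_le) linarith
      then have "sqrt (real n) * (1 / \<omega> (n - s n)) \<le> real (card {n - s n..n}) * (1 / \<omega> (n - s n))"
        by (intro mult_right_mono) (auto simp: less_imp_le[OF pos])
      also have "\<dots> \<le> (\<Sum>k=n - s n..n. 1 / \<omega> k)"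
        by (intro sum_bounded_below divide_left_mono mult_pos_pos pos antimonoD[OF 2]) auto
      also have "\<dots> \<le> kernel_diag \<omega> n 1"
        unfolding kernel_diag_def by (auto intro!: sum_mono2 simp: less_imp_le[OF pos])
      finally have "\<omega> n * (sqrt (real n) * (1 / \<omega> (n - s n))) \<le> \<omega> n * kernel_diag \<omega> n 1"
        by (intro mult_left_mono) (auto simp: less_imp_le[OF pos])
      then show "\<omega> n / \<omega> (n - s n) * sqrt (real n) \<le> \<omega> n * kernel_diag \<omega> n 1"
        by (simp add: mult_ac)
    qed
  qed
qed

section \<open>Decay of the normalised kernels\<close>

text \<open>Abel summation: multiplying by 1 - u leaves two boundary terms and the increments of b,
  whose absolute values telescope to |b N - b 0| by monotonicity.\<close>

lemma norm_power_sum_monotone_le: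
  fixes u :: complex and b :: "nat \<Rightarrow> real"
  assumes mono: "mono b \<or> antimono b" and nonneg: "\<And>k. 0 \<le> b k" and u: "cmod u \<le> 1"
  shows "cmod (1 - u) * cmod (\<Sum>k\<le>N. u ^ k * of_real (b k)) \<le> 2 * (b 0 + b N)"
proof -
  have power: "cmod (u ^ k) \<le> 1" for k
    using u by (simp add: norm_power power_le_one)
  have "(1 - u) * (\<Sum>k\<le>N. u ^ k * of_real (b k))
      = of_real (b 0) - u ^ Suc N * of_real (b N) + (\<Sum>k<N. u ^ Suc k * of_real (b (Suc k) - b k))"
    by (induction N) (simp_all add: algebra_simps)
  then have "cmod (1 - u) * cmod (\<Sum>k\<le>N. u ^ k * of_real (b k))
      = cmod (of_real (b 0) - u ^ Suc N * of_real (b N) + (\<Sum>k<N. u ^ Suc k * of_real (b (Suc k) - b k)))"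
    by (simp only: norm_mult[symmetric])
  also have "\<dots> \<le> cmod (of_real (b 0)) + cmod (u ^ Suc N * of_real (b N))
      + cmod (\<Sum>k<N. u ^ Suc k * of_real (b (Suc k) - b k))"
    by (intro norm_triangle_le add_mono norm_triangle_ineq4 order_refl)
  also have "\<dots> \<le> b 0 + b N + (b 0 + b N)"
  proof (intro add_mono)
    show "cmod (u ^ Suc N * of_real (b N)) \<le> b N"
      using mult_right_mono[OF power nonneg] nonneg[of N] by (simp add: norm_mult del: power_Suc)
    have "cmod (\<Sum>k<N. u ^ Suc k * of_real (b (Suc k) - b k)) \<le> (\<Sum>k<N. \<bar>b (Suc k) - b k\<bar>)"
    proof (rule sum_norm_le)
      fix k
      show "cmod (u ^ Suc k * of_real (b (Suc k) - b k)) \<le> \<bar>b (Suc k) - b k\<bar>"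
        using mult_right_mono[OF power[of "Suc k"] abs_ge_zero[of "b (Suc k) - b k"]]
        unfolding norm_mult norm_of_real by simp
    qed
    also have "\<dots> = \<bar>b N - b 0\<bar>"
      using mono
    proof
      assume "mono b"
      then have "(\<Sum>k<N. \<bar>b (Suc k) - b k\<bar>) = (\<Sum>k<N. b (Suc k) - b k)"
        by (intro sum.cong refl) (simp add: monoD)
      then show ?thesis
        using monoD[OF \<open>mono b\<close>, of 0 N] by (simp add: sum_lessThan_telescope)
    next
      assume "antimono b"
      then have "(\<Sum>k<N. \<bar>b (Suc k) - b k\<bar>) = (\<Sum>k<N. b k - b (Suc k))"
        by (intro sum.cong refl) (simp add: antimonoD)
      then show ?thesis
        using antimonoD[OF \<open>antimono b\<close>, of 0 N] by (simp add: sum_lessThan_telescope')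
    qed
    also have "\<dots> \<le> b 0 + b N"
      using nonneg[of 0] nonneg[of N] by linarith
    finally show "cmod (\<Sum>k<N. u ^ Suc k * of_real (b (Suc k) - b k)) \<le> b 0 + b N" .
  qed (use nonneg in auto)
  finally show ?thesis
    by simp
qed

lemma sum_le_last_term_if_geometric_growth:
  fixes a :: "nat \<Rightarrow> real"
  assumes pos: "\<And>k. 0 < a k" and s: "1 < s" and growth: "\<And>k. k0 \<le> k \<Longrightarrow> s * a k \<le> a (Suc k)"
  shows "\<exists>C. \<forall>N\<ge>k0. (\<Sum>k\<le>N. a k) \<le> C * a N"
proof -
  \<comment> \<open>The first entry covers the base case \<open>k0\<close>; the second is the
    solution of C / s + 1 = C, so any larger C survives the induction step.\<close>
  define C where "C = max ((\<Sum>k\<le>k0. a k) / a k0) (s / (s - 1))"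
  have C: "s / (s - 1) \<le> C"
    by (simp add: C_def)
  moreover have "0 < s / (s - 1)"
    using s by simp
  ultimately have C0: "0 < C"
    by linarith
  have C': "C / s + 1 \<le> C"
    using C s by (simp add: field_simps)
  have "(\<Sum>k\<le>N. a k) \<le> C * a N" if "k0 \<le> N" for N
    using that
  proof (induction N rule: dec_induct)
    case base
    have "(\<Sum>k\<le>k0. a k) / a k0 \<le> C"
      by (simp add: C_def)
    then show ?case
      using pos[of k0] by (simp add: field_simps)
  next
    case (step N)
    have "(\<Sum>k\<le>Suc N. a k) \<le> C * a N + a (Suc N)"
      using step.IH by simp
    also have "\<dots> \<le> C * (a (Suc N) / s) + a (Suc N)"
      using growth[OF step.hyps(1)] s C0 by (intro add_mono mult_left_mono) (auto simp: field_simps)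
    also have "\<dots> = (C / s + 1) * a (Suc N)"
      by (simp add: algebra_simps)
    also have "\<dots> \<le> C * a (Suc N)"
      using C' by (intro mult_right_mono) (auto simp: less_imp_le[OF pos])
    finally show ?case .
  qed
  then show ?thesis
    by blast
qed

text \<open>On the circle k(w,w) = k(1,1), so the denominator is k(1,1) itself. Since |1 - cnj(w) z|
  = |w - z| stays away from 0 on K, Abel summation bounds the numerator by a multiple of 1 + 1 /
  \<open>\<omega> N\<close>.\<close>

lemma kernel_negligible_unit_circle:
  assumes \<omega>: "weight \<omega>" and w: "cmod w = 1" and K: "compact K" "K \<subseteq> cball 0 1" "w \<notin> K"
  shows "uniform_limit K (\<lambda>N z. cmod (poly (rep_kernel \<omega> N w) z) /
      sqrt (kernel_diag \<omega> N 1 * kernel_diag \<omega> N w)) (\<lambda>_. 0) sequentially"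
proof -
  note pos = weight_pos[OF \<omega>]
  obtain \<delta> where \<delta>: "\<delta> > 0" "\<And>z. z \<in> K \<Longrightarrow> \<delta> \<le> dist w z"
    using separate_point_closed[OF compact_imp_closed[OF K(1)] K(3)] by blast
  define \<sigma> where "\<sigma> N = kernel_diag \<omega> N 1" for N
  have \<sigma>: "0 < \<sigma> N" for N
    unfolding \<sigma>_def by (rule kernel_diag_pos[OF pos])
  define g where "g N = 2 / \<delta> * (1 / \<sigma> N + 1 / (\<omega> N * \<sigma> N))" for N
  have "g \<longlonglongrightarrow> 2 / \<delta> * (0 + 0)"
    unfolding g_def \<sigma>_def
    by (intro tendsto_intros tendsto_divide_0[OF tendsto_const]
        filterlim_at_top_imp_at_infinity weight_kernel_diag_1_at_top[OF \<omega>]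
        weight_mult_kernel_diag_1_at_top[OF \<omega>])
  then have lim: "uniform_limit K (\<lambda>N z. g N) (\<lambda>_. 0) sequentially"
    by (simp add: uniform_limit_iff tendsto_iff)
  have bound: "norm (cmod (poly (rep_kernel \<omega> N w) z) / sqrt (kernel_diag \<omega> N 1 * kernel_diag \<omega> N w)) \<le> g N"
    if "z \<in> K" for N z
  proof -
    have "kernel_diag \<omega> N w = \<sigma> N"
      using w by (simp add: \<sigma>_def kernel_diag_def)
    then have "sqrt (kernel_diag \<omega> N 1 * kernel_diag \<omega> N w) = \<sigma> N"
      using \<sigma>[of N] by (simp add: \<sigma>_def[symmetric] real_sqrt_mult_self)
    define u where "u = cnj w * z"
    have "1 - u = cnj w * (w - z)"
      using w complex_norm_square[of w] by (simp add: u_def algebra_simps)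
    then have "\<delta> \<le> cmod (1 - u)"
      using \<delta>(2)[OF that] w by (simp add: norm_mult dist_norm)
    have mono: "mono (\<lambda>k. 1 / \<omega> k) \<or> antimono (\<lambda>k. 1 / \<omega> k)"
    proof -
      have "mono \<omega> \<or> antimono \<omega>"
        using \<omega> by (simp add: weight_def)
      then show ?thesis
        by (auto simp: monotone_def intro!: divide_left_mono less_imp_le[OF pos] mult_pos_pos pos)
    qed
    have "\<delta> * cmod (poly (rep_kernel \<omega> N w) z) \<le> cmod (1 - u) * cmod (\<Sum>k\<le>N. u ^ k * of_real (1 / \<omega> k))"
      using \<open>\<delta> \<le> cmod (1 - u)\<close> by (simp add: poly_rep_kernel u_def mult_right_mono)
    also have "\<dots> \<le> 2 * (1 / \<omega> 0 + 1 / \<omega> N)"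
      using that K(2) w by (intro norm_power_sum_monotone_le mono)
        (auto simp: u_def norm_mult less_imp_le[OF pos])
    finally have "cmod (poly (rep_kernel \<omega> N w) z) \<le> 2 * (1 + 1 / \<omega> N) / \<delta>"
      using \<omega> \<delta>(1) by (simp add: weight_def field_simps)
    then have "cmod (poly (rep_kernel \<omega> N w) z) / \<sigma> N \<le> 2 * (1 + 1 / \<omega> N) / \<delta> / \<sigma> N"
      using \<sigma>[of N] by (intro divide_right_mono) auto
    also have "\<dots> = g N"
      using \<sigma>[of N] pos[of N] \<delta>(1) by (simp add: g_def field_simps)
    finally show ?thesis
      using \<open>sqrt _ = \<sigma> N\<close> \<sigma>[of N] by simp
  qed
  show ?thesis
    by (rule uniform_limit_null_comparison[OF _ lim]) (intro always_eventually allI ballI bound)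
qed

text \<open>On the closed disc the numerator is at most the sum of the \<open>a k\<close>, hence at
  most a multiple of \<open>a N\<close>. The last term of k(w,w) alone is
  \<open>(a N)^2 * \<omega> N\<close>, so \<open>a N\<close> cancels and a multiple of 1 /
  sqrt(\<open>\<omega> N * \<sigma> N\<close>) remains.\<close>

lemma kernel_negligible_outside:
  assumes \<omega>: "weight \<omega>" and w: "1 < cmod w" and K: "K \<subseteq> cball 0 1"
  shows "uniform_limit K (\<lambda>N z. cmod (poly (rep_kernel \<omega> N w) z) /
      sqrt (kernel_diag \<omega> N 1 * kernel_diag \<omega> N w)) (\<lambda>_. 0) sequentially"
proof -
  note pos = weight_pos[OF \<omega>]
  define \<sigma> where "\<sigma> N = kernel_diag \<omega> N 1" for N
  have \<sigma>: "0 < \<sigma> N" for N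
    unfolding \<sigma>_def by (rule kernel_diag_pos[OF pos])
  define a where "a k = cmod w ^ k / \<omega> k" for k
  have w0: "0 < cmod w"
    using w by linarith
  have a: "0 < a k" for k
    using w0 pos by (simp add: a_def)
  \<comment> \<open>The midpoint of 1 and |w|: consecutive weight ratios are eventually below |w| /
    s > 1, which makes \<open>a\<close> grow by the factor s at each step.\<close>
  define s where "s = (1 + cmod w) / 2"
  have s: "1 < s" "1 < cmod w / s"
    using w by (auto simp: s_def field_simps)
  obtain k0 where k0: "\<And>k. k0 \<le> k \<Longrightarrow> \<omega> (Suc k) / \<omega> k < cmod w / s"
    using order_tendstoD(2)[OF weight_ratio_tendsto[OF \<omega>] s(2)]
    by (auto simp: eventually_sequentially)
  have "s * a k \<le> a (Suc k)" if "k0 \<le> k" for k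
  proof -
    have "s * \<omega> (Suc k) \<le> cmod w * \<omega> k"
      using k0[OF that] s(1) pos[of k] by (simp add: field_simps)
    then have "cmod w ^ k * (s * \<omega> (Suc k)) \<le> cmod w ^ k * (cmod w * \<omega> k)"
      by (intro mult_left_mono) auto
    then show ?thesis
      using pos[of k] pos[of "Suc k"] by (simp add: a_def field_simps)
  qed
  from sum_le_last_term_if_geometric_growth[of a s k0, OF a s(1) this]
  obtain C where C: "\<And>N. k0 \<le> N \<Longrightarrow> (\<Sum>k\<le>N. a k) \<le> C * a N"
    by blast
  define g where "g N = C / sqrt (\<omega> N * \<sigma> N)" for N
  have "g \<longlonglongrightarrow> 0"
    unfolding g_def \<sigma>_def
    by (intro tendsto_divide_0[OF tendsto_const] filterlim_at_top_imp_at_infinity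
        filterlim_compose[OF sqrt_at_top] weight_mult_kernel_diag_1_at_top[OF \<omega>])
  then have lim: "uniform_limit K (\<lambda>N z. g N) (\<lambda>_. 0) sequentially"
    by (simp add: uniform_limit_iff tendsto_iff)
  have bound: "norm (cmod (poly (rep_kernel \<omega> N w) z) / sqrt (kernel_diag \<omega> N 1 * kernel_diag \<omega> N w)) \<le> g N"
    if z: "z \<in> K" and N: "k0 \<le> N" for N z
  proof -
    have "cmod (poly (rep_kernel \<omega> N w) z) \<le> (\<Sum>k\<le>N. a k)"
      unfolding poly_rep_kernel
    proof (rule sum_norm_le)
      fix k
      have "cmod w ^ k * cmod z ^ k \<le> cmod w ^ k * 1"
        using z K by (intro mult_left_mono power_le_one) auto
      then show "cmod ((cnj w * z) ^ k / of_real (\<omega> k)) \<le> a k"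
        using pos[of k]
        by (simp add: a_def norm_divide norm_mult norm_power power_mult_distrib divide_right_mono)
    qed
    also note C[OF N]
    finally have num: "cmod (poly (rep_kernel \<omega> N w) z) \<le> C * a N" .
    then have C0: "0 \<le> C"
      using a[of N] norm_ge_zero[of "poly (rep_kernel \<omega> N w) z"]
      by (meson order_trans zero_le_mult_iff not_le)
    have "(a N)\<^sup>2 * \<omega> N = (cmod w ^ N)\<^sup>2 / \<omega> N"
      using pos[of N] by (simp add: a_def power2_eq_square)
    also have "\<dots> \<le> kernel_diag \<omega> N w"
      unfolding kernel_diag_def by (intro member_le_sum) (auto simp: less_imp_le[OF pos])
    finally have "\<sigma> N * ((a N)\<^sup>2 * \<omega> N) \<le> \<sigma> N * kernel_diag \<omega> N w"
      using \<sigma>[of N] by (intro mult_left_mono) auto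
    then have "sqrt ((a N)\<^sup>2 * (\<omega> N * \<sigma> N)) \<le> sqrt (\<sigma> N * kernel_diag \<omega> N w)"
      by (intro real_sqrt_le_mono) (simp add: mult_ac)
    then have den: "a N * sqrt (\<omega> N * \<sigma> N) \<le> sqrt (\<sigma> N * kernel_diag \<omega> N w)"
      using a[of N] by (simp add: real_sqrt_mult)
    have den_pos: "0 < a N * sqrt (\<omega> N * \<sigma> N)"
      using a[of N] pos[of N] \<sigma>[of N] by simp
    have "cmod (poly (rep_kernel \<omega> N w) z) / sqrt (\<sigma> N * kernel_diag \<omega> N w)
        \<le> (C * a N) / (a N * sqrt (\<omega> N * \<sigma> N))"
      using num den den_pos C0 a[of N] by (intro frac_le) auto
    also have "\<dots> = g N"
      using a[of N] by (simp add: g_def)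
    finally show ?thesis
      using \<sigma>[of N] kernel_diag_pos[of \<omega> N w, OF pos] by (simp add: \<sigma>_def)
  qed
  show ?thesis
    by (rule uniform_limit_null_comparison[OF _ lim]) (intro eventually_sequentiallyI[of k0] ballI bound)
qed

section \<open>Uniform convergence of the residual\<close>

lemma uniform_limit_sum_zero:
  fixes F :: "'i \<Rightarrow> nat \<Rightarrow> 'a \<Rightarrow> 'b :: real_normed_vector"
  assumes "\<And>i. i \<in> A \<Longrightarrow> uniform_limit K (F i) (\<lambda>_. 0) sequentially"
  shows "uniform_limit K (\<lambda>n z. \<Sum>i\<in>A. F i n z) (\<lambda>_. 0) sequentially"
  using assms
proof (induction A rule: infinite_finite_induct)
  case (insert i A)
  then have "uniform_limit K (\<lambda>n z. F i n z + (\<Sum>i\<in>A. F i n z)) (\<lambda>_. 0 + 0) sequentially"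
    by (intro uniform_limit_add) auto
  with insert.hyps show ?case by simp
qed (simp_all add: uniform_limit_const)

theorem theorem1p5:
  fixes \<omega> :: "nat \<Rightarrow> real" and f :: "complex poly" and p :: "nat \<Rightarrow> complex poly"
  assumes "weight \<omega>"
    and "\<And>z. poly f z = 0 \<Longrightarrow> order z f = 1"
    and "{z. poly f z = 0} \<inter> ball 0 1 = {}"
    and "\<And>n. optimal_approximant \<omega> (poly f) n (p n)"
  shows "\<forall>K. compact K \<and> K \<subseteq> cball 0 1 - {z. poly f z = 0} \<longrightarrow>
           uniform_limit K (\<lambda>n z. 1 - poly (p n) z * poly f z) (\<lambda>_. 0) sequentially"
proof (intro allI impI)
  fix K :: "complex set"
  assume K: "compact K \<and> K \<subseteq> cball 0 1 - {z. poly f z = 0}"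
  define Q where "Q w N z = cmod (poly (rep_kernel \<omega> N w) z) /
      sqrt (kernel_diag \<omega> N 1 * kernel_diag \<omega> N w)" for w N z
  \<comment> \<open>Optimality includes that f is nonzero somewhere in the disc.\<close>
  have f0: "f \<noteq> 0"
    using assms(4)[of 0] by (auto simp: optimal_approximant_def)
  have sf: "rsquarefree f"
    using f0 assms(2) unfolding rsquarefree_def by (metis order_root)
  have roots: "1 \<le> cmod z" if "poly f z = 0" for z
    using assms(3) that by (auto simp: disjoint_iff not_less)
  obtain B where B: "\<And>k. \<omega> (Suc k) \<le> B * \<omega> k" "\<And>k. \<omega> k \<le> B * \<omega> (Suc k)"
    using weight_ratio_bounded[OF assms(1)] by blast
  obtain C where C: "\<And>n z. cmod (1 - poly (p n) z * poly f z)
      \<le> C * (\<Sum>w | poly f w = 0. Q w (n + degree f) z)"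
    using residual_bound[of \<omega> B f p, OF weight_pos[OF assms(1)] B sf roots assms(4)]
    unfolding Q_def by blast
  \<comment> \<open>Zeros on the circle use that K avoids them; the remaining zeros have modulus
    greater than 1.\<close>
  have "uniform_limit K (Q w) (\<lambda>_. 0) sequentially" if "poly f w = 0" for w
  proof (cases "cmod w = 1")
    case True
    with K that show ?thesis
      unfolding Q_def by (intro kernel_negligible_unit_circle assms(1)) auto
  next
    case False
    with K roots[OF that] show ?thesis
      unfolding Q_def by (intro kernel_negligible_outside assms(1)) auto
  qed
  then have "uniform_limit K (\<lambda>n z. \<Sum>w | poly f w = 0. Q w n z) (\<lambda>_. 0) sequentially"
    by (intro uniform_limit_sum_zero) auto
  then have "uniform_limit K (\<lambda>n z. \<Sum>w | poly f w = 0. Q w (n + degree f) z) (\<lambda>_. 0) sequentially"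
    by (rule filterlim_compose) (rule filterlim_add_const_nat_at_top)
  then have lim: "uniform_limit K (\<lambda>n z. C * (\<Sum>w | poly f w = 0. Q w (n + degree f) z)) (\<lambda>_. C * 0) sequentially"
    by (intro bounded_linear.uniform_limit[OF bounded_linear_mult_right])
  show "uniform_limit K (\<lambda>n z. 1 - poly (p n) z * poly f z) (\<lambda>_. 0) sequentially"
    by (rule uniform_limit_null_comparison[OF _ lim[unfolded mult_zero_right]])
      (intro always_eventually allI ballI C)
qed

end
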